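(* Let $\mathcal{A}$ be an approximable quasi-ats. Then applicative bisimulation coincides with the logical preorder: ${\lesssim^B}={\lesssim^{\mathcal{L}}}$.
   Context: A quasi-ats is $(A,ev)$ with $ev:A\rightharpoonup(A\to A)$; write $a\Downarrow f$ if $ev(a)=f$, $a\Uparrow$ if $ev(a)$ is undefined, and $ab=f(b)$ if $a\Downarrow f$ (and $ab=a$ if $a\Uparrow$). Applicative bisimulation $\lesssim^B$ is the largest relation $R$ such that $aRb$ and $a\Downarrow f$ imply $b\Downarrow g$ and $f(c)\,R\,g(c)$ for all $c\in A$. The logic $\mathcal{L}$ has formulas $\phi::=t\mid\phi\wedge\psi\mid(\phi\to\psi)_\bot$ ($t$ = true), with $a\models t$ always, conjunction as usual, and $a\models(\phi\to\psi)_\bot$ iff $a\Downarrow f$ and for all $b$, $b\models\phi$ implies $f(b)\models\psi$. Let $\lambda\equiv(t\to t)_\bot$, so $a\models\lambda$ iff $a\Downarrow$. Define $a\lesssim^{\mathcal{L}}b$ iff every formula of $\mathcal{L}$ satisfied by $a$ is satisfied by $b$. $\mathcal{A}$ is approximable if whenever $ab_1\cdots b_n\Downarrow$ there are $\phi_1,\dots,\phi_n\in\mathcal{L}$ with $a\models(\phi_1\to\cdots(\phi_n\to\lambda)_\bot\cdots)_\bot$ and $b_i\models\phi_i$ for $1\le i\le n$. *)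

theory Defs
  imports Main
begin

text \<open>
  A quasi-ats is given by its evaluation map \<open>ev :: 'a \<rightharpoonup> ('a \<Rightarrow> 'a)\<close>; the underlying set is the
  type \<open>'a\<close>. There are no further conditions on \<open>ev\<close>.
\<close>

type_synonym 'a quasi_ats = "'a \<rightharpoonup> ('a \<Rightarrow> 'a)"

definition converges :: "'a quasi_ats \<Rightarrow> 'a \<Rightarrow> bool" where
  "converges ev a \<longleftrightarrow> (\<exists>f. ev a = Some f)"

definition app :: "'a quasi_ats \<Rightarrow> 'a \<Rightarrow> 'a \<Rightarrow> 'a" where
  "app ev a b = (case ev a of Some f \<Rightarrow> f b | None \<Rightarrow> a)"

definition apps :: "'a quasi_ats \<Rightarrow> 'a \<Rightarrow> 'a list \<Rightarrow> 'a" where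
  "apps ev a bs = foldl (app ev) a bs"

definition applicative_simulation :: "'a quasi_ats \<Rightarrow> ('a \<Rightarrow> 'a \<Rightarrow> bool) \<Rightarrow> bool" where
  "applicative_simulation ev R \<longleftrightarrow>
    (\<forall>a b f. R a b \<and> ev a = Some f \<longrightarrow> (\<exists>g. ev b = Some g \<and> (\<forall>c. R (f c) (g c))))"

definition bisim_le :: "'a quasi_ats \<Rightarrow> 'a \<Rightarrow> 'a \<Rightarrow> bool" where
  "bisim_le ev a b \<longleftrightarrow> (\<exists>R. applicative_simulation ev R \<and> R a b)"

lemma applicative_simulation_bisim_le: "applicative_simulation ev (bisim_le ev)"
  unfolding applicative_simulation_def
proof (intro allI impI, elim conjE)
  fix a b f
  assume ab: "bisim_le ev a b" and f: "ev a = Some f"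
  from ab obtain R where R: "applicative_simulation ev R" and Rab: "R a b"
    unfolding bisim_le_def by blast
  from R have "R a b \<and> ev a = Some f \<longrightarrow> (\<exists>g. ev b = Some g \<and> (\<forall>c. R (f c) (g c)))"
    unfolding applicative_simulation_def by (elim allE)
  with Rab f obtain g where g: "ev b = Some g" and fg: "\<And>c. R (f c) (g c)"
    by auto
  have "bisim_le ev (f c) (g c)" for c
    unfolding bisim_le_def using R fg by (intro exI[of _ R] conjI)
  with g show "\<exists>g. ev b = Some g \<and> (\<forall>c. bisim_le ev (f c) (g c))"
    by (intro exI[of _ g] conjI allI)
qed

lemma bisim_le_greatest: "applicative_simulation ev R \<Longrightarrow> R \<le> bisim_le ev"
  by (intro predicate2I) (auto simp: bisim_le_def)

datatype form = Truth | Conj form form | Arrow form form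

primrec sat :: "'a quasi_ats \<Rightarrow> 'a \<Rightarrow> form \<Rightarrow> bool" where
  "sat ev a Truth \<longleftrightarrow> True"
| "sat ev a (Conj \<phi> \<psi>) \<longleftrightarrow> sat ev a \<phi> \<and> sat ev a \<psi>"
| "sat ev a (Arrow \<phi> \<psi>) \<longleftrightarrow>
    (\<exists>f. ev a = Some f \<and> (\<forall>b. sat ev b \<phi> \<longrightarrow> sat ev (f b) \<psi>))"

definition lam :: form where
  "lam = Arrow Truth Truth"

lemma sat_lam_iff: "sat ev a lam \<longleftrightarrow> converges ev a"
  by (simp add: lam_def converges_def)

definition logic_le :: "'a quasi_ats \<Rightarrow> 'a \<Rightarrow> 'a \<Rightarrow> bool" where
  "logic_le ev a b \<longleftrightarrow> (\<forall>\<phi>. sat ev a \<phi> \<longrightarrow> sat ev b \<phi>)"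

definition arrows :: "form list \<Rightarrow> form \<Rightarrow> form" where
  "arrows \<phi>s \<psi> = foldr Arrow \<phi>s \<psi>"

definition approximable :: "'a quasi_ats \<Rightarrow> bool" where
  "approximable ev \<longleftrightarrow>
    (\<forall>a bs. converges ev (apps ev a bs) \<longrightarrow>
      (\<exists>\<phi>s. length \<phi>s = length bs \<and> sat ev a (arrows \<phi>s lam) \<and>
        (\<forall>i < length bs. sat ev (bs ! i) (\<phi>s ! i))))"

end

theory Submission
  imports Defs
begin

text \<open>
  The link between the two preorders is the contextual preorder: every \<open>bs\<close> for which
  \<open>apps ev a bs\<close> converges also makes \<open>apps ev b bs\<close> converge. It is always an applicative
  simulation, and approximability turns convergence of \<open>apps ev a bs\<close> into a formula satisfied
  by \<open>a\<close>, so it contains the logical preorder.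
\<close>

text \<open>For an arrow, both functions are applied to the same argument, so its premise is tested
  on one element and only the conclusion has to pass from \<open>f c\<close> to
  \<open>g c\<close>.\<close>

lemma applicative_simulation_sat:
  assumes "applicative_simulation ev R" "R a b" "sat ev a \<phi>"
  shows "sat ev b \<phi>"
  using assms(2,3)
proof (induction \<phi> arbitrary: a b)
  case (Arrow \<phi> \<psi>)
  then obtain f where f: "ev a = Some f" "\<And>c. sat ev c \<phi> \<Longrightarrow> sat ev (f c) \<psi>"
    by auto
  with assms(1) Arrow.prems(1) obtain g where "ev b = Some g" "\<And>c. R (f c) (g c)"
    unfolding applicative_simulation_def by blast
  with f Arrow.IH(2) show ?case
    by auto
qed auto

lemma applicative_simulation_converges_apps:
  "applicative_simulation ev
    (\<lambda>a b. \<forall>bs. converges ev (apps ev a bs) \<longrightarrow> converges ev (apps ev b bs))"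
  (is "applicative_simulation ev ?R")
  unfolding applicative_simulation_def
proof (intro allI impI, elim conjE)
  fix a b f
  assume R: "?R a b" and f: "ev a = Some f"
  \<comment> \<open>The empty argument list turns \<open>?R a b\<close> into plain convergence of
    \<open>b\<close>.\<close>
  from R[rule_format, of "[]"] f obtain g where g: "ev b = Some g"
    by (auto simp: apps_def converges_def)
  have "?R (f c) (g c)" for c
  proof (intro allI impI)
    fix bs
    assume "converges ev (apps ev (f c) bs)"
    \<comment> \<open>Since \<open>f c\<close> is \<open>app ev a c\<close>, running
      \<open>f c\<close> on \<open>bs\<close> is running \<open>a\<close> on \<open>c # bs\<close>;
      likewise for \<open>g c\<close> and \<open>b\<close>.\<close>
    then show "converges ev (apps ev (g c) bs)"
      using R[rule_format, of "c # bs"] f g by (simp add: apps_def app_def)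
  qed
  with g show "\<exists>g. ev b = Some g \<and> (\<forall>c. ?R (f c) (g c))"
    by blast
qed

text \<open>Iterated modus ponens, peeling off one arrow per argument.\<close>

lemma sat_arrows_apps:
  assumes "length \<phi>s = length bs" "sat ev a (arrows \<phi>s \<psi>)"
    "\<And>i. i < length bs \<Longrightarrow> sat ev (bs ! i) (\<phi>s ! i)"
  shows "sat ev (apps ev a bs) \<psi>"
  using assms
proof (induction \<phi>s bs arbitrary: a rule: list_induct2)
  case Nil
  then show ?case
    by (simp add: arrows_def apps_def)
next
  case (Cons \<phi> \<phi>s c bs)
  from Cons.prems(2)[of 0] have "sat ev c \<phi>"
    by simp
  \<comment> \<open>Satisfying an arrow forces \<open>ev a\<close> to be defined, so the default
    value of \<open>app\<close> does not arise.\<close>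
  with Cons.prems(1) have "sat ev (app ev a c) (arrows \<phi>s \<psi>)"
    by (auto simp: arrows_def app_def)
  moreover have "sat ev (bs ! i) (\<phi>s ! i)" if "i < length bs" for i
    using Cons.prems(2)[of "Suc i"] that by simp
  ultimately have "sat ev (apps ev (app ev a c) bs) \<psi>"
    by (rule Cons.IH)
  then show ?case
    by (simp add: apps_def)
qed

lemma logic_le_converges_apps:
  assumes "approximable ev" "logic_le ev a b" "converges ev (apps ev a bs)"
  shows "converges ev (apps ev b bs)"
proof -
  from assms(1,3) obtain \<phi>s where \<phi>s: "length \<phi>s = length bs" "sat ev a (arrows \<phi>s lam)"
    "\<And>i. i < length bs \<Longrightarrow> sat ev (bs ! i) (\<phi>s ! i)"
    unfolding approximable_def by blast
  \<comment> \<open>Only this formula moves from \<open>a\<close> to \<open>b\<close>: the arguments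
    \<open>bs\<close> are shared and already satisfy \<open>\<phi>s\<close>.\<close>
  from \<phi>s(2) assms(2) have "sat ev b (arrows \<phi>s lam)"
    by (simp add: logic_le_def)
  with \<phi>s have "sat ev (apps ev b bs) lam"
    by (intro sat_arrows_apps)
  then show ?thesis
    by (simp add: sat_lam_iff)
qed

theorem mainTheorem17:
  fixes ev :: "'a quasi_ats"
  assumes "approximable ev"
  shows "bisim_le ev = logic_le ev"
proof (rule antisym)
  show "bisim_le ev \<le> logic_le ev"
    using applicative_simulation_sat[OF applicative_simulation_bisim_le]
    by (auto simp: logic_le_def)
  have "logic_le ev \<le>
      (\<lambda>a b. \<forall>bs. converges ev (apps ev a bs) \<longrightarrow> converges ev (apps ev b bs))"
    using logic_le_converges_apps[OF assms] by blast
  also have "\<dots> \<le> bisim_le ev"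
    by (rule bisim_le_greatest[OF applicative_simulation_converges_apps])
  finally show "logic_le ev \<le> bisim_le ev" .
qed

end
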